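(* Let $G$ and $H$ be graphs, where $G$ has order $n$. If $H=K_1$, then $\gamma_{\{R2\}}(G[H])=n+\gamma(G)$; otherwise $\gamma_{\{R2\}}(G[H])=2n$.
   Context: All graphs are finite and simple. A Roman $\{2\}$-dominating function on a graph $G=(V,E)$ is a function $f:V\to\{0,1,2\}$ such that for every vertex $v$ with $f(v)=0$, $\sum_{u\in N(v)}f(u)\geq 2$. Its weight is $\sum_{v\in V}f(v)$, and $\gamma_{\{R2\}}(G)$ is the minimum weight of such a function. $\gamma(G)$ is the domination number. The corona $G[H]$ is constructed as follows: label the vertices of $G$ as $1,\dots,n$; take one copy of $G$ and $n$ disjoint copies $H_1,\dots,H_n$ of $H$, and join every vertex of $H_i$ to vertex $i$ of $G$. *)

theory Defs
  imports "Graph_Theory.Graph_Theory"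
begin

(* Finite simple graphs are the symmetric loop-free digraphs of locale pair_graph:
   each undirected edge uv is represented by both pairs (u,v) and (v,u).
   The locale admits the graph without vertices. *)

definition neighborhood :: "'a pair_pre_digraph \<Rightarrow> 'a \<Rightarrow> 'a set" where
  "neighborhood G v = {u. (v, u) \<in> parcs G}"

definition dominating_set :: "'a pair_pre_digraph \<Rightarrow> 'a set \<Rightarrow> bool" where
  "dominating_set G D \<longleftrightarrow>
     D \<subseteq> pverts G \<and> (\<forall>v \<in> pverts G - D. neighborhood G v \<inter> D \<noteq> {})"

definition domination_number :: "'a pair_pre_digraph \<Rightarrow> nat" where
  "domination_number G = (LEAST k. \<exists>D. dominating_set G D \<and> card D = k)"

(* Values of f outside pverts G are unconstrained and never used
   (neighborhoods of vertices stay inside pverts G). *)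
definition roman2_dominating :: "'a pair_pre_digraph \<Rightarrow> ('a \<Rightarrow> nat) \<Rightarrow> bool" where
  "roman2_dominating G f \<longleftrightarrow>
     (\<forall>v \<in> pverts G. f v \<in> {0, 1, 2}) \<and>
     (\<forall>v \<in> pverts G. f v = 0 \<longrightarrow> (\<Sum>u \<in> neighborhood G v. f u) \<ge> 2)"

definition weight :: "'a pair_pre_digraph \<Rightarrow> ('a \<Rightarrow> nat) \<Rightarrow> nat" where
  "weight G f = (\<Sum>v \<in> pverts G. f v)"

definition roman2_domination_number :: "'a pair_pre_digraph \<Rightarrow> nat" where
  "roman2_domination_number G = (LEAST k. \<exists>f. roman2_dominating G f \<and> weight G f = k)"

(* Inl i is the vertex i of G, and Inr (i, x) is the vertex x in the copy of H
   belonging to i; the vertices of G themselves serve as the labels 1, ..., n. *)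
definition corona ::
  "'a pair_pre_digraph \<Rightarrow> 'b pair_pre_digraph \<Rightarrow> ('a + 'a \<times> 'b) pair_pre_digraph" where
  "corona G H = \<lparr>
     pverts = Inl ` pverts G \<union> Inr ` (pverts G \<times> pverts H),
     parcs =
       {(Inl i, Inl j) | i j. (i, j) \<in> parcs G} \<union>
       {(Inr (i, x), Inr (i, y)) | i x y. i \<in> pverts G \<and> (x, y) \<in> parcs H} \<union>
       {(Inl i, Inr (i, x)) | i x. i \<in> pverts G \<and> x \<in> pverts H} \<union>
       {(Inr (i, x), Inl i) | i x. i \<in> pverts G \<and> x \<in> pverts H} \<rparr>"

lemma domination_number_attained:
  "\<exists>D. dominating_set G D \<and> card D = domination_number G"
proof -
  have "dominating_set G (pverts G)"
    by (simp add: dominating_set_def)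
  then have "\<exists>k D. dominating_set G D \<and> card D = k"
    by blast
  then show ?thesis
    unfolding domination_number_def by (rule LeastI_ex)
qed

lemma roman2_domination_number_attained:
  "\<exists>f. roman2_dominating G f \<and> weight G f = roman2_domination_number G"
proof -
  have "roman2_dominating G (\<lambda>_. 2)"
    by (simp add: roman2_dominating_def)
  then have "\<exists>k f. roman2_dominating G f \<and> weight G f = k"
    by blast
  then show ?thesis
    unfolding roman2_domination_number_def by (rule LeastI_ex)
qed

lemma pair_graph_corona:
  assumes "pair_graph G" and "pair_graph H"
  shows "pair_graph (corona G H)"
proof -
  interpret G: pair_graph G by fact
  interpret H: pair_graph H by fact
  have sub: "parcs (corona G H) \<subseteq> pverts (corona G H) \<times> pverts (corona G H)"
    by (auto simp: corona_def dest: G.in_arcsD1 G.in_arcsD2 H.in_arcsD1 H.in_arcsD2)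
  have fin: "finite (pverts (corona G H))"
    by (simp add: corona_def)
  have symG: "(j, i) \<in> parcs G" if "(i, j) \<in> parcs G" for i j
    using G.pair_sym_arcs that by (auto simp: symmetric_def dest: symD)
  have symH: "(j, i) \<in> parcs H" if "(i, j) \<in> parcs H" for i j
    using H.pair_sym_arcs that by (auto simp: symmetric_def dest: symD)
  have "sym (parcs (corona G H))"
    by (rule symI) (auto simp: corona_def intro: symG symH)
  moreover have "fst e \<noteq> snd e" if "e \<in> parcs (corona G H)" for e
    using that by (auto simp: corona_def dest: G.pair_no_loops H.pair_no_loops)
  moreover have "finite (parcs (corona G H))"
    using sub fin by (meson finite_SigmaI finite_subset)
  ultimately show ?thesis
    using sub fin by unfold_locales (auto simp: symmetric_def)
qed

end

theory Submission
  imports Defs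
begin

text \<open>
  Call the \<^emph>\<open>fibre weight\<close> of a vertex \<open>i\<close> of \<open>G\<close> the total value of \<open>f\<close> on \<open>i\<close> and its copy of
  \<open>H\<close>. A zero inside the copy sees only this fibre, so it forces the fibre weight to be at least 2;
  without such a zero the fibre weight is at least the order of \<open>H\<close>. Hence every fibre weighs at
  least 2 unless \<open>H = K\<^sub>1\<close>, and the value 2 on \<open>G\<close> with 0 elsewhere attains this bound.
  If \<open>H = K\<^sub>1\<close>, a fibre of weight 1 has its value 1 on the leaf, so its vertex of \<open>G\<close> needs a
  neighbour of positive value, whose fibre then weighs at least 2: the vertices with fibre weight
  at least 2 dominate \<open>G\<close>. Conversely, 1 on all leaves and on a dominating set is feasible.
\<close>

section \<open>General facts on minima, sums and finite graphs\<close>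

lemma domination_number_le:
  assumes "dominating_set G D"
  shows "domination_number G \<le> card D"
  unfolding domination_number_def using assms by (blast intro: Least_le)

lemma roman2_domination_number_le:
  assumes "roman2_dominating G f"
  shows "roman2_domination_number G \<le> weight G f"
  unfolding roman2_domination_number_def using assms by (blast intro: Least_le)

lemma roman2_domination_number_ge:
  assumes "\<And>f. roman2_dominating G f \<Longrightarrow> k \<le> weight G f"
  shows "k \<le> roman2_domination_number G"
  using roman2_domination_number_attained[of G] assms by metis

text \<open>Counts the weight in both bounds for a one-vertex \<open>H\<close>: the summand is the
  exact fibre weight of the constructed function, and a lower estimate of the fibre weight of an
  arbitrary one.\<close>

lemma sum_Suc_of_bool:
  assumes "finite A" and "D \<subseteq> A"
  shows "(\<Sum>i \<in> A. Suc (of_bool (i \<in> D))) = card A + card D"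
proof -
  have "(\<Sum>i \<in> A. Suc (of_bool (i \<in> D))) = (\<Sum>i \<in> A. 1 + of_bool (i \<in> D))"
    by simp
  also have "\<dots> = card A + card (A \<inter> D)"
    unfolding sum.distrib using assms(1) by (simp add: sum.If_cases of_bool_def)
  also have "A \<inter> D = D"
    using assms(2) by blast
  finally show ?thesis .
qed

lemma neighborhood_subset:
  assumes "pair_graph G"
  shows "neighborhood G v \<subseteq> pverts G"
proof -
  interpret pair_graph G by fact
  show ?thesis by (auto simp: neighborhood_def dest: in_arcsD2)
qed

lemma finite_pverts:
  assumes "pair_graph G"
  shows "finite (pverts G)"
proof -
  interpret pair_graph G by fact
  show ?thesis by (rule pair_finite_verts)
qed

lemma finite_neighborhood:
  assumes "pair_graph G"
  shows "finite (neighborhood G v)"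
  using neighborhood_subset[OF assms] finite_pverts[OF assms] by (rule finite_subset)

text \<open>Without loops a single vertex carries no arcs, so the order alone decides whether a
  graph is \<open>K_1\<close>. This turns the case distinction of the theorem into one on the order
  of \<open>H\<close>.\<close>

lemma complete_digraph_1_iff:
  assumes "pair_graph G"
  shows "K\<^bsub>1\<^esub> (with_proj G) \<longleftrightarrow> card (pverts G) = 1"
proof
  assume "card (pverts G) = 1"
  then obtain x where x: "pverts G = {x}"
    by (auto simp: card_1_singleton_iff)
  interpret pair_graph G by fact
  have "parcs G = {}"
    using in_arcsD1 in_arcsD2 pair_no_loops x by fastforce
  then show "K\<^bsub>1\<^esub> (with_proj G)"
    by (auto simp: complete_digraph_pair_def x)
qed (simp add: complete_digraph_pair_def)

section \<open>Weight and neighbourhoods in the corona, fibre by fibre\<close>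

definition fibre_weight ::
  "'b pair_pre_digraph \<Rightarrow> ('a + 'a \<times> 'b \<Rightarrow> nat) \<Rightarrow> 'a \<Rightarrow> nat" where
  "fibre_weight H f i = f (Inl i) + (\<Sum>x \<in> pverts H. f (Inr (i, x)))"

lemma weight_corona:
  assumes "finite (pverts G)" and "finite (pverts H)"
  shows "weight (corona G H) f = (\<Sum>i \<in> pverts G. fibre_weight H f i)"
proof -
  have "weight (corona G H) f =
      sum f (Inl ` pverts G) + sum f (Inr ` (pverts G \<times> pverts H))"
    unfolding weight_def corona_def using assms by (auto intro!: sum.union_disjoint)
  also have "\<dots> = (\<Sum>i \<in> pverts G. f (Inl i)) + (\<Sum>p \<in> pverts G \<times> pverts H. f (Inr p))"
    by (simp add: sum.reindex)
  also have "\<dots> = (\<Sum>i \<in> pverts G. fibre_weight H f i)"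
    by (simp add: fibre_weight_def sum.distrib sum.cartesian_product)
  finally show ?thesis .
qed

lemma sum_neighborhood_corona_Inl:
  assumes "pair_graph G" and "pair_graph H" and "i \<in> pverts G"
  shows "(\<Sum>u \<in> neighborhood (corona G H) (Inl i). f u) =
    (\<Sum>j \<in> neighborhood G i. f (Inl j)) + (\<Sum>x \<in> pverts H. f (Inr (i, x)))"
proof -
  have "neighborhood (corona G H) (Inl i) =
      Inl ` neighborhood G i \<union> (\<lambda>x. Inr (i, x)) ` pverts H"
    using assms(3) by (auto simp: neighborhood_def corona_def)
  then have "(\<Sum>u \<in> neighborhood (corona G H) (Inl i). f u) =
      sum f (Inl ` neighborhood G i) + sum f ((\<lambda>x. Inr (i, x)) ` pverts H)"
    using finite_neighborhood[OF assms(1)] finite_pverts[OF assms(2)]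
    by (auto intro!: sum.union_disjoint)
  then show ?thesis
    by (simp add: sum.reindex inj_on_def)
qed

lemma sum_neighborhood_corona_Inr:
  assumes "pair_graph H" and "i \<in> pverts G" and "x \<in> pverts H"
  shows "(\<Sum>u \<in> neighborhood (corona G H) (Inr (i, x)). f u) =
    f (Inl i) + (\<Sum>y \<in> neighborhood H x. f (Inr (i, y)))"
proof -
  have "neighborhood (corona G H) (Inr (i, x)) =
      insert (Inl i) ((\<lambda>y. Inr (i, y)) ` neighborhood H x)"
    using assms(2,3) by (auto simp: neighborhood_def corona_def)
  then have "(\<Sum>u \<in> neighborhood (corona G H) (Inr (i, x)). f u) =
      f (Inl i) + sum f ((\<lambda>y. Inr (i, y)) ` neighborhood H x)"
    using finite_neighborhood[OF assms(1)] by (simp add: image_iff)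
  then show ?thesis
    by (simp add: sum.reindex inj_on_def)
qed

text \<open>Moves feasibility from the sum type to conditions on \<open>G\<close> and
  \<open>H\<close>. Only the condition at \<open>Inl i\<close> involves other fibres.\<close>

lemma roman2_dominating_corona_iff:
  assumes "pair_graph G" and "pair_graph H"
  shows "roman2_dominating (corona G H) f \<longleftrightarrow>
    (\<forall>i \<in> pverts G. f (Inl i) \<in> {0, 1, 2} \<and>
      (f (Inl i) = 0 \<longrightarrow>
        2 \<le> (\<Sum>j \<in> neighborhood G i. f (Inl j)) + (\<Sum>x \<in> pverts H. f (Inr (i, x)))) \<and>
      (\<forall>x \<in> pverts H. f (Inr (i, x)) \<in> {0, 1, 2} \<and>
        (f (Inr (i, x)) = 0 \<longrightarrow>
          2 \<le> f (Inl i) + (\<Sum>y \<in> neighborhood H x. f (Inr (i, y))))))"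
proof -
  have V: "(\<forall>v \<in> pverts (corona G H). P v) \<longleftrightarrow>
      (\<forall>i \<in> pverts G. P (Inl i) \<and> (\<forall>x \<in> pverts H. P (Inr (i, x))))" for P
    by (auto simp: corona_def)
  show ?thesis
    unfolding roman2_dominating_def V
    using sum_neighborhood_corona_Inl[OF assms, of _ f]
      sum_neighborhood_corona_Inr[OF assms(2), of _ G _ f]
    by (simp cong: ball_cong) blast
qed

section \<open>Lower bounds for one fibre\<close>

lemma fibre_weight_ge_2_if_zero:
  assumes "pair_graph G" and "pair_graph H" and "roman2_dominating (corona G H) f"
    and "i \<in> pverts G" and "x \<in> pverts H" and "f (Inr (i, x)) = 0"
  shows "2 \<le> fibre_weight H f i"
proof -
  have "2 \<le> f (Inl i) + (\<Sum>y \<in> neighborhood H x. f (Inr (i, y)))"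
    using assms roman2_dominating_corona_iff[OF assms(1,2)] by blast
  also have "\<dots> \<le> fibre_weight H f i"
    unfolding fibre_weight_def
    using neighborhood_subset[OF assms(2)] finite_pverts[OF assms(2)]
    by (simp add: sum_mono2)
  finally show ?thesis .
qed

text \<open>The term \<open>f (Inl i)\<close> is kept for a copy with one vertex: there a positive
  value at \<open>i\<close> lifts the bound from 1 to 2.\<close>

lemma fibre_weight_ge_card:
  assumes "\<And>x. x \<in> pverts H \<Longrightarrow> f (Inr (i, x)) \<noteq> 0"
  shows "f (Inl i) + card (pverts H) \<le> fibre_weight H f i"
proof -
  have "card (pverts H) = (\<Sum>x \<in> pverts H. 1)"
    by simp
  also have "\<dots> \<le> (\<Sum>x \<in> pverts H. f (Inr (i, x)))"
    using assms by (intro sum_mono) (simp add: Suc_leI)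
  finally show ?thesis
    by (simp add: fibre_weight_def)
qed

section \<open>The value \<open>2 * card (pverts G)\<close>\<close>

lemma roman2_domination_number_corona_le:
  assumes "pair_graph G" and "pair_graph H"
  shows "roman2_domination_number (corona G H) \<le> 2 * card (pverts G)"
proof -
  define f :: "'a + 'a \<times> 'b \<Rightarrow> nat" where "f = case_sum (\<lambda>_. 2) (\<lambda>_. 0)"
  have "roman2_dominating (corona G H) f"
    unfolding roman2_dominating_corona_iff[OF assms] by (simp add: f_def)
  moreover have "weight (corona G H) f = 2 * card (pverts G)"
    using assms by (simp add: weight_corona finite_pverts fibre_weight_def f_def)
  ultimately show ?thesis
    using roman2_domination_number_le by metis
qed

lemma roman2_domination_number_corona_ge:
  assumes "pair_graph G" and "pair_graph H" and "2 \<le> card (pverts H)"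
  shows "2 * card (pverts G) \<le> roman2_domination_number (corona G H)"
proof (rule roman2_domination_number_ge)
  fix f assume f: "roman2_dominating (corona G H) f"
  have "2 \<le> fibre_weight H f i" if "i \<in> pverts G" for i
    using fibre_weight_ge_2_if_zero[OF assms(1,2) f that]
      fibre_weight_ge_card[of H f i] assms(3) by force
  then have "(\<Sum>i \<in> pverts G. 2) \<le> (\<Sum>i \<in> pverts G. fibre_weight H f i)"
    by (rule sum_mono)
  then show "2 * card (pverts G) \<le> weight (corona G H) f"
    using assms(1,2) by (simp add: weight_corona finite_pverts)
qed

section \<open>Copies with a single vertex\<close>

lemma roman2_domination_number_corona_singleton_le:
  assumes G: "pair_graph G" and H: "pair_graph H" and x: "pverts H = {x}"
  shows "roman2_domination_number (corona G H) \<le> card (pverts G) + domination_number G"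
proof -
  obtain D where D: "dominating_set G D" and card_D: "card D = domination_number G"
    using domination_number_attained by blast
  define f :: "'a + 'a \<times> 'b \<Rightarrow> nat" where "f = case_sum (\<lambda>i. of_bool (i \<in> D)) (\<lambda>_. 1)"
  \<comment> \<open>The vertices \<open>i\<close> outside \<open>D\<close> are the only zeros of
    \<open>f\<close>. The leaf of \<open>i\<close> supplies 1, so the neighbours in \<open>G\<close>
    must supply only 1 more.\<close>
  have "1 \<le> (\<Sum>j \<in> neighborhood G i. f (Inl j))" if i: "i \<in> pverts G" "i \<notin> D" for i
  proof -
    obtain j where j: "j \<in> neighborhood G i" "j \<in> D"
      using D i by (auto simp: dominating_set_def)
    have "f (Inl j) \<le> (\<Sum>j \<in> neighborhood G i. f (Inl j))"
      using j finite_neighborhood[OF G] by (intro member_le_sum) auto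
    then show ?thesis using j by (simp add: f_def)
  qed
  then have "roman2_dominating (corona G H) f"
    unfolding roman2_dominating_corona_iff[OF G H] by (auto simp: x f_def)
  moreover have "weight (corona G H) f = card (pverts G) + card D"
    using D finite_pverts[OF G] finite_pverts[OF H]
    by (simp add: weight_corona fibre_weight_def f_def x sum_Suc_of_bool dominating_set_def)
  ultimately show ?thesis
    using roman2_domination_number_le card_D by metis
qed

lemma roman2_domination_number_corona_singleton_ge:
  assumes G: "pair_graph G" and H: "pair_graph H" and x: "pverts H = {x}"
  shows "card (pverts G) + domination_number G \<le> roman2_domination_number (corona G H)"
proof (rule roman2_domination_number_ge)
  fix f assume f: "roman2_dominating (corona G H) f"
  \<comment> \<open>The first alternative comes from a positive leaf, the second from a zero leaf.
    Either way the fibre weighs at least 1, and at least 2 if \<open>f (Inl i)\<close> is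
    positive.\<close>
  have ge: "f (Inl i) + 1 \<le> fibre_weight H f i \<or> 2 \<le> fibre_weight H f i"
    if "i \<in> pverts G" for i
    using fibre_weight_ge_2_if_zero[OF G H f that] fibre_weight_ge_card[of H f i] x by force
  define D where "D = {i \<in> pverts G. 2 \<le> fibre_weight H f i}"
  have "neighborhood G i \<inter> D \<noteq> {}" if i: "i \<in> pverts G - D" for i
  proof -
    have "fibre_weight H f i < 2" and "f (Inl i) = 0"
      using i ge[of i] by (auto simp: D_def)
    moreover from this have "2 \<le> (\<Sum>j \<in> neighborhood G i. f (Inl j)) + f (Inr (i, x))"
      using f i x by (auto simp: roman2_dominating_corona_iff[OF G H])
    \<comment> \<open>As \<open>f (Inl i) = 0\<close>, the leaf carries the whole fibre weight,
      which is below 2, so it cannot supply the required 2 alone.\<close>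
    ultimately have "(\<Sum>j \<in> neighborhood G i. f (Inl j)) \<noteq> 0"
      by (simp add: fibre_weight_def x)
    then obtain j where j: "j \<in> neighborhood G i" "f (Inl j) \<noteq> 0"
      by (meson sum.neutral)
    then have "j \<in> pverts G"
      using neighborhood_subset[OF G] by blast
    then have "j \<in> D"
      using ge[of j] j(2) by (auto simp: D_def)
    then show ?thesis using j(1) by blast
  qed
  then have "dominating_set G D"
    by (auto simp: dominating_set_def D_def)
  then have "card (pverts G) + domination_number G \<le> card (pverts G) + card D"
    by (simp add: domination_number_le)
  also have "\<dots> = (\<Sum>i \<in> pverts G. Suc (of_bool (i \<in> D)))"
    using finite_pverts[OF G] by (subst sum_Suc_of_bool) (auto simp: D_def)
  also have "\<dots> \<le> (\<Sum>i \<in> pverts G. fibre_weight H f i)"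
    using ge by (intro sum_mono) (force simp: D_def)
  finally show "card (pverts G) + domination_number G \<le> weight (corona G H) f"
    using G H by (simp add: weight_corona finite_pverts)
qed

theorem theorem3p2:
  fixes G :: "'a pair_pre_digraph" and H :: "'b pair_pre_digraph" and n :: nat
  assumes "pair_graph G" and "pair_graph H"
    and "pverts H \<noteq> {}"
    and "card (pverts G) = n"
  shows "(K\<^bsub>1\<^esub> (with_proj H) \<longrightarrow>
            roman2_domination_number (corona G H) = n + domination_number G) \<and>
         (\<not> K\<^bsub>1\<^esub> (with_proj H) \<longrightarrow>
            roman2_domination_number (corona G H) = 2 * n)"
proof (intro conjI impI)
  assume "K\<^bsub>1\<^esub> (with_proj H)"
  then obtain x where x: "pverts H = {x}"
    using complete_digraph_1_iff[OF assms(2)] by (auto simp: card_1_singleton_iff)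
  show "roman2_domination_number (corona G H) = n + domination_number G"
    using roman2_domination_number_corona_singleton_le[OF assms(1,2) x]
      roman2_domination_number_corona_singleton_ge[OF assms(1,2) x] assms(4) by simp
next
  assume "\<not> K\<^bsub>1\<^esub> (with_proj H)"
  \<comment> \<open>Order 0 must be ruled out: the corona would be a copy of \<open>G\<close>, where
    the constant 1 is feasible with weight \<open>n\<close>.\<close>
  moreover have "card (pverts H) \<noteq> 0"
    using assms(3) finite_pverts[OF assms(2)] by simp
  ultimately have "2 \<le> card (pverts H)"
    using complete_digraph_1_iff[OF assms(2)] by linarith
  then show "roman2_domination_number (corona G H) = 2 * n"
    using roman2_domination_number_corona_le[OF assms(1,2)]
      roman2_domination_number_corona_ge[OF assms(1,2)] assms(4) by simp
qed

end
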